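(* Let $Y$ be a closed linear subspace of $L_1=L_1([0,1])$ whose closed unit ball $B_Y$ is relatively compact with respect to the topology of convergence in measure. Then $Y$, equipped with the norm $\|\cdot\|_1$ inherited from $L_1$, is asymptotically midpoint uniformly convex.
   Context: Scalars are real. $L_1=L_1([0,1])$ is the Banach space of (classes of) Lebesgue integrable functions on $[0,1]$ with the norm $\|f\|_1=\int_0^1|f|$. The topology of convergence in measure is the usual (metrizable) topology on the space $L_0([0,1])$ of all classes of measurable functions: $f_n\to f$ in measure iff $\lambda(\{|f_n-f|\ge\eta\})\to 0$ for every $\eta>0$, where $\lambda$ is Lebesgue measure. A set is relatively compact for this topology if its closure in $L_0([0,1])$ is compact. For a Banach space $(X,\|\cdot\|_X)$, $B_X$ is its closed unit ball, $S_X$ its unit sphere, and $\mathrm{cof}(X)$ is the set of closed finite-codimensional linear subspaces of $X$. The modulus of asymptotic midpoint uniform convexity is, for $t\in(0,\infty)$, $$\tilde\delta_X(t)=\inf_{x\in S_X}\ \sup_{Z\in\mathrm{cof}(X)}\ \inf_{z\in S_Z}\bigl(\max\{\|x+tz\|_X,\|x-tz\|_X\}-1\bigr),$$ with the convention that the infimum over an empty set is $+\infty$. The space $X$ (more precisely its norm) is asymptotically midpoint uniformly convex if $\tilde\delta_X(t)>0$ for every $t>0$. *)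

theory Defs
  imports "HOL-Analysis.Analysis"
begin

abbreviation unit_leb :: "real measure" where
  "unit_leb \<equiv> lebesgue_on {0..1}"

lemma space_unit_leb: "space unit_leb = {0..1}"
  by simp

lemma finite_measure_unit_leb: "finite_measure unit_leb"
  by (rule finite_measureI) (simp add: emeasure_restrict_space)

definition ae_eq :: "(real \<Rightarrow> real) \<Rightarrow> (real \<Rightarrow> real) \<Rightarrow> bool" where
  "ae_eq f g \<longleftrightarrow> f \<in> borel_measurable unit_leb \<and> g \<in> borel_measurable unit_leb
     \<and> (AE x in unit_leb. f x = g x)"

lemma part_equivp_ae_eq: "part_equivp ae_eq"
proof (rule part_equivpI)
  show "\<exists>f. ae_eq f f"
    by (rule exI[of _ "\<lambda>_. 0"]) (simp add: ae_eq_def)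
  show "symp ae_eq"
    by (rule sympI) (auto simp: ae_eq_def eq_commute)
  show "transp ae_eq"
    by (rule transpI) (unfold ae_eq_def, elim conjE, intro conjI, simp, simp, force)
qed

quotient_type L0 = "real \<Rightarrow> real" / partial: ae_eq
  by (rule part_equivp_ae_eq)

instantiation L0 :: real_vector
begin

lift_definition zero_L0 :: L0 is "\<lambda>_. 0"
  by (simp add: ae_eq_def)

lift_definition plus_L0 :: "L0 \<Rightarrow> L0 \<Rightarrow> L0" is "\<lambda>f g x. f x + g x"
  unfolding ae_eq_def by (intro conjI; force)

lift_definition minus_L0 :: "L0 \<Rightarrow> L0 \<Rightarrow> L0" is "\<lambda>f g x. f x - g x"
  unfolding ae_eq_def by (intro conjI; force)

lift_definition uminus_L0 :: "L0 \<Rightarrow> L0" is "\<lambda>f x. - f x"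
  unfolding ae_eq_def by (intro conjI; force)

lift_definition scaleR_L0 :: "real \<Rightarrow> L0 \<Rightarrow> L0" is "\<lambda>c f x. c * f x"
  unfolding ae_eq_def by (intro conjI; force)

instance
  by standard (transfer; force simp: ae_eq_def algebra_simps)+

end

lemma integrable_min_abs_diff:
  fixes f g :: "real \<Rightarrow> real"
  assumes [measurable]: "f \<in> borel_measurable unit_leb" "g \<in> borel_measurable unit_leb"
  shows "integrable unit_leb (\<lambda>x. min 1 \<bar>f x - g x\<bar>)"
  by (rule finite_measure.integrable_const_bound[OF finite_measure_unit_leb, of _ 1]) auto

text \<open>The metric below induces convergence in measure, see \<open>tendsto_L0_iff\<close>.\<close>

instantiation L0 :: metric_space
begin

lift_definition dist_L0 :: "L0 \<Rightarrow> L0 \<Rightarrow> real" is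
  "\<lambda>f g. LINT x|unit_leb. min 1 \<bar>f x - g x\<bar>"
proof -
  fix f f' g g' assume "ae_eq f f'" "ae_eq g g'"
  then have m: "f \<in> borel_measurable unit_leb" "f' \<in> borel_measurable unit_leb"
    "g \<in> borel_measurable unit_leb" "g' \<in> borel_measurable unit_leb"
    and ae: "AE x in unit_leb. f x = f' x" "AE x in unit_leb. g x = g' x"
    by (auto simp: ae_eq_def)
  show "(LINT x|unit_leb. min 1 \<bar>f x - g x\<bar>) = (LINT x|unit_leb. min 1 \<bar>f' x - g' x\<bar>)"
  proof (rule integral_cong_AE)
    show "AE x in unit_leb. min 1 \<bar>f x - g x\<bar> = min 1 \<bar>f' x - g' x\<bar>"
      using ae by eventually_elim simp
  qed (use m in \<open>auto intro!: borel_measurable_integrable integrable_min_abs_diff\<close>)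
qed

definition uniformity_L0 :: "(L0 \<times> L0) filter" where
  "uniformity_L0 = (INF e\<in>{0<..}. principal {(x, y). dist x y < e})"

definition open_L0 :: "L0 set \<Rightarrow> bool" where
  "open_L0 U \<longleftrightarrow> (\<forall>x\<in>U. eventually (\<lambda>(x', y). x' = x \<longrightarrow> y \<in> U) uniformity)"

instance
proof
  fix f g h :: L0
  show "dist f g = 0 \<longleftrightarrow> f = g"
  proof transfer
    fix f g assume "ae_eq f f" "ae_eq g g"
    then have m: "f \<in> borel_measurable unit_leb" "g \<in> borel_measurable unit_leb"
      by (auto simp: ae_eq_def)
    have "(LINT x|unit_leb. min 1 \<bar>f x - g x\<bar>) = 0
        \<longleftrightarrow> (AE x in unit_leb. min 1 \<bar>f x - g x\<bar> = 0)"
      by (rule integral_nonneg_eq_0_iff_AE[OF integrable_min_abs_diff[OF m]]) auto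
    also have "\<dots> \<longleftrightarrow> ae_eq f g"
      using m by (auto simp: ae_eq_def min_def intro!: AE_cong)
    finally show "(LINT x|unit_leb. min 1 \<bar>f x - g x\<bar>) = 0 \<longleftrightarrow> ae_eq f g" .
  qed
  show "dist f g \<le> dist f h + dist g h"
  proof transfer
    fix f g h assume "ae_eq f f" "ae_eq g g" "ae_eq h h"
    then have m: "f \<in> borel_measurable unit_leb" "g \<in> borel_measurable unit_leb"
      "h \<in> borel_measurable unit_leb"
      by (auto simp: ae_eq_def)
    note i = integrable_min_abs_diff[OF m(1,2)] integrable_min_abs_diff[OF m(1,3)]
      integrable_min_abs_diff[OF m(2,3)]
    have "(LINT x|unit_leb. min 1 \<bar>f x - g x\<bar>)
        \<le> (LINT x|unit_leb. min 1 \<bar>f x - h x\<bar> + min 1 \<bar>g x - h x\<bar>)"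
      by (rule integral_mono) (use i in auto)
    then show "(LINT x|unit_leb. min 1 \<bar>f x - g x\<bar>)
        \<le> (LINT x|unit_leb. min 1 \<bar>f x - h x\<bar>) + (LINT x|unit_leb. min 1 \<bar>g x - h x\<bar>)"
      using i by simp
  qed
qed (simp_all add: uniformity_L0_def open_L0_def)

end

lift_definition meas_ge_L0 :: "real \<Rightarrow> L0 \<Rightarrow> real" is
  "\<lambda>\<eta> f. measure unit_leb {x \<in> {0..1}. \<bar>f x\<bar> \<ge> \<eta>}"
proof -
  fix \<eta> :: real and f g assume "ae_eq f g"
  then have [measurable]: "f \<in> borel_measurable unit_leb" "g \<in> borel_measurable unit_leb"
    and ae: "AE x in unit_leb. f x = g x"
    by (auto simp: ae_eq_def)
  have "measure unit_leb {x \<in> space unit_leb. \<bar>f x\<bar> \<ge> \<eta>}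
      = measure unit_leb {x \<in> space unit_leb. \<bar>g x\<bar> \<ge> \<eta>}"
  proof (rule measure_eq_AE)
    show "AE x in unit_leb. x \<in> {x \<in> space unit_leb. \<bar>f x\<bar> \<ge> \<eta>}
        \<longleftrightarrow> x \<in> {x \<in> space unit_leb. \<bar>g x\<bar> \<ge> \<eta>}"
      using ae by eventually_elim simp
  qed measurable
  then show "measure unit_leb {x \<in> {0..1}. \<bar>f x\<bar> \<ge> \<eta>}
      = measure unit_leb {x \<in> {0..1}. \<bar>g x\<bar> \<ge> \<eta>}"
    unfolding space_unit_leb .
qed

lemma dist_L0_le:
  assumes "0 \<le> \<eta>" shows "dist f g \<le> \<eta> + meas_ge_L0 \<eta> (f - g)"
  using assms
proof transfer
  fix \<eta> :: real and f g assume e: "0 \<le> \<eta>" and "ae_eq f f" "ae_eq g g"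
  then have m[measurable]: "f \<in> borel_measurable unit_leb" "g \<in> borel_measurable unit_leb"
    by (auto simp: ae_eq_def)
  interpret finite_measure unit_leb by (rule finite_measure_unit_leb)
  let ?A = "{x \<in> space unit_leb. \<bar>f x - g x\<bar> \<ge> \<eta>}"
  have A: "?A \<in> sets unit_leb" by measurable
  have i: "integrable unit_leb (indicat_real ?A)"
    by (rule integrable_real_indicator[OF A]) (simp add: emeasure_eq_measure)
  have "(LINT x|unit_leb. min 1 \<bar>f x - g x\<bar>) \<le> (LINT x|unit_leb. \<eta> + indicat_real ?A x)"
  proof (rule integral_mono)
    show "min 1 \<bar>f x - g x\<bar> \<le> \<eta> + indicat_real ?A x" if "x \<in> space unit_leb" for x
      using e that by (auto simp: indicator_def)
  qed (intro Bochner_Integration.integrable_add i integrable_min_abs_diff[OF m]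
      finite_measure.integrable_const finite_measure_unit_leb)+
  also have "\<dots> = \<eta> * measure unit_leb (space unit_leb) + measure unit_leb ?A"
    by (simp only: Bochner_Integration.integral_add[OF integrable_const i]
        lebesgue_integral_const Bochner_Integration.integral_indicator sets.Int_space_eq2[OF A]
        real_scaleR_def mult.commute)
  finally show "(LINT x|unit_leb. min 1 \<bar>f x - g x\<bar>)
      \<le> \<eta> + measure unit_leb {x \<in> {0..1}. \<bar>f x - g x\<bar> \<ge> \<eta>}"
    unfolding space_unit_leb by (simp add: measure_restrict_space)
qed

lemma meas_ge_L0_le:
  assumes "0 < \<eta>" shows "min 1 \<eta> * meas_ge_L0 \<eta> (f - g) \<le> dist f g"
  using assms
proof transfer
  fix \<eta> :: real and f g assume e: "0 < \<eta>" and "ae_eq f f" "ae_eq g g"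
  then have m[measurable]: "f \<in> borel_measurable unit_leb" "g \<in> borel_measurable unit_leb"
    by (auto simp: ae_eq_def)
  interpret finite_measure unit_leb by (rule finite_measure_unit_leb)
  let ?A = "{x \<in> space unit_leb. \<bar>f x - g x\<bar> \<ge> \<eta>}"
  have A: "?A \<in> sets unit_leb" by measurable
  have i: "integrable unit_leb (indicat_real ?A)"
    by (rule integrable_real_indicator[OF A]) (simp add: emeasure_eq_measure)
  have "min 1 \<eta> * measure unit_leb ?A = (LINT x|unit_leb. min 1 \<eta> * indicat_real ?A x)"
    by (simp only: integral_mult_right_zero Bochner_Integration.integral_indicator
        sets.Int_space_eq2[OF A])
  also have "\<dots> \<le> (LINT x|unit_leb. min 1 \<bar>f x - g x\<bar>)"
  proof (rule integral_mono)
    show "min 1 \<eta> * indicat_real ?A x \<le> min 1 \<bar>f x - g x\<bar>" if "x \<in> space unit_leb" for x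
      using e that by (auto simp: indicator_def)
  qed (intro integrable_mult_right i integrable_min_abs_diff[OF m])+
  finally show "min 1 \<eta> * measure unit_leb {x \<in> {0..1}. \<bar>f x - g x\<bar> \<ge> \<eta>}
      \<le> (LINT x|unit_leb. min 1 \<bar>f x - g x\<bar>)"
    unfolding space_unit_leb .
qed

lemma meas_ge_L0_nonneg: "0 \<le> meas_ge_L0 \<eta> f"
  by transfer simp

theorem tendsto_L0_iff:
  "(F \<longlonglongrightarrow> f) \<longleftrightarrow> (\<forall>\<eta>>0. (\<lambda>n. meas_ge_L0 \<eta> (F n - f)) \<longlonglongrightarrow> 0)"
proof
  assume "F \<longlonglongrightarrow> f"
  then have d: "(\<lambda>n. dist (F n) f) \<longlonglongrightarrow> 0"
    by (rule tendsto_dist_iff[THEN iffD1])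
  show "\<forall>\<eta>>0. (\<lambda>n. meas_ge_L0 \<eta> (F n - f)) \<longlonglongrightarrow> 0"
  proof (intro allI impI)
    fix \<eta> :: real assume e: "\<eta> > 0"
    have q: "(\<lambda>n. dist (F n) f / min 1 \<eta>) \<longlonglongrightarrow> 0"
      using tendsto_divide[OF d tendsto_const, of "min 1 \<eta>"] e by (simp add: min_def)
    have le: "meas_ge_L0 \<eta> (F n - f) \<le> dist (F n) f / min 1 \<eta>" for n
      using meas_ge_L0_le[OF e, of "F n" f] e
      by (simp add: pos_le_divide_eq mult.commute)
    show "(\<lambda>n. meas_ge_L0 \<eta> (F n - f)) \<longlonglongrightarrow> 0"
      by (rule tendsto_sandwich[OF _ _ tendsto_const q])
        (simp_all add: meas_ge_L0_nonneg le)
  qed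
next
  assume R: "\<forall>\<eta>>0. (\<lambda>n. meas_ge_L0 \<eta> (F n - f)) \<longlonglongrightarrow> 0"
  show "F \<longlonglongrightarrow> f"
  proof (rule tendstoI)
    fix e :: real assume e: "e > 0"
    then have "\<forall>\<^sub>F n in sequentially. meas_ge_L0 (e/2) (F n - f) < e/2"
      using R by (intro order_tendstoD(2)[where y=0]) auto
    then show "\<forall>\<^sub>F n in sequentially. dist (F n) f < e"
    proof eventually_elim
      case (elim n)
      then show ?case using dist_L0_le[of "e/2" "F n" f] e by simp
    qed
  qed
qed

lift_definition integrable_L0 :: "L0 \<Rightarrow> bool" is "integrable unit_leb"
  unfolding ae_eq_def by (elim conjE, rule integrable_cong_AE) auto

typedef L1 = "{f. integrable_L0 f}"
  morphisms L0_of_L1 L1_of_L0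
  by (rule exI[of _ 0], simp, transfer, simp)

setup_lifting type_definition_L1

lift_definition integral_abs_L0 :: "L0 \<Rightarrow> real" is "\<lambda>f. LINT x|unit_leb. \<bar>f x\<bar>"
  unfolding ae_eq_def
  by (elim conjE, rule integral_cong_AE) (auto elim: eventually_mono)

instantiation L1 :: real_vector
begin

lift_definition zero_L1 :: L1 is 0
  by (transfer, simp)

lift_definition plus_L1 :: "L1 \<Rightarrow> L1 \<Rightarrow> L1" is "(+)"
  by (transfer, simp)

lift_definition minus_L1 :: "L1 \<Rightarrow> L1 \<Rightarrow> L1" is "(-)"
  by (transfer, simp)

lift_definition uminus_L1 :: "L1 \<Rightarrow> L1" is uminus
  by (transfer, simp)

lift_definition scaleR_L1 :: "real \<Rightarrow> L1 \<Rightarrow> L1" is scaleR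
  by (transfer, simp)

instance
  by standard (transfer, simp add: algebra_simps)+

end

instantiation L1 :: real_normed_vector
begin

lift_definition norm_L1 :: "L1 \<Rightarrow> real" is integral_abs_L0 .

definition dist_L1 :: "L1 \<Rightarrow> L1 \<Rightarrow> real" where
  "dist_L1 f g = norm (f - g)"

definition sgn_L1 :: "L1 \<Rightarrow> L1" where
  "sgn_L1 f = f /\<^sub>R norm f"

definition uniformity_L1 :: "(L1 \<times> L1) filter" where
  "uniformity_L1 = (INF e\<in>{0<..}. principal {(x, y). dist x y < e})"

definition open_L1 :: "L1 set \<Rightarrow> bool" where
  "open_L1 U \<longleftrightarrow> (\<forall>x\<in>U. eventually (\<lambda>(x', y). x' = x \<longrightarrow> y \<in> U) uniformity)"

instance
proof
  fix f g :: L1 and a :: real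
  show "norm f = 0 \<longleftrightarrow> f = 0"
  proof (transfer, transfer)
    fix f assume f: "ae_eq f f" "integrable unit_leb f"
    then have "(LINT x|unit_leb. \<bar>f x\<bar>) = 0 \<longleftrightarrow> (AE x in unit_leb. \<bar>f x\<bar> = 0)"
      by (intro integral_nonneg_eq_0_iff_AE) auto
    then show "(LINT x|unit_leb. \<bar>f x\<bar>) = 0 \<longleftrightarrow> ae_eq f (\<lambda>_. 0)"
      using f by (simp add: ae_eq_def)
  qed
  show "norm (f + g) \<le> norm f + norm g"
  proof (transfer, transfer)
    fix f g :: "real \<Rightarrow> real" assume f: "integrable unit_leb f" "integrable unit_leb g"
    have "(LINT x|unit_leb. \<bar>f x + g x\<bar>) \<le> (LINT x|unit_leb. \<bar>f x\<bar> + \<bar>g x\<bar>)"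
      by (rule integral_mono) (use f in auto)
    then show "(LINT x|unit_leb. \<bar>f x + g x\<bar>)
        \<le> (LINT x|unit_leb. \<bar>f x\<bar>) + (LINT x|unit_leb. \<bar>g x\<bar>)"
      using f by simp
  qed
  show "norm (a *\<^sub>R f) = \<bar>a\<bar> * norm f"
    by (transfer, transfer) (simp add: abs_mult)
qed (simp_all add: dist_L1_def sgn_L1_def uniformity_L1_def open_L1_def)

end

lemma L1_cases:
  obtains g where "integrable unit_leb g" "f = L1_of_L0 (abs_L0 g)"
proof -
  have "\<exists>g. ae_eq g g \<and> u = abs_L0 g" for u
    by (induct u rule: L0.abs_induct) auto
  then obtain g where g: "ae_eq g g" "L0_of_L1 f = abs_L0 g"
    by blast
  moreover have "integrable unit_leb g"
    using L0_of_L1[of f] g by (simp add: integrable_L0.abs_eq)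
  ultimately show ?thesis
    using that L0_of_L1_inverse by metis
qed

lemma norm_diff_L1:
  assumes "integrable unit_leb g" "integrable unit_leb h"
  shows "norm (L1_of_L0 (abs_L0 g) - L1_of_L0 (abs_L0 h)) = (LINT x|unit_leb. \<bar>g x - h x\<bar>)"
proof -
  have e: "ae_eq k k" if "integrable unit_leb k" for k
    using that by (auto simp: ae_eq_def)
  have r: "L0_of_L1 (L1_of_L0 (abs_L0 k)) = abs_L0 k" if "integrable unit_leb k" for k
    using that e by (simp add: L1_of_L0_inverse integrable_L0.abs_eq)
  show ?thesis
    using assms e
    by (simp add: norm_L1.rep_eq minus_L1.rep_eq r minus_L0.abs_eq integral_abs_L0.abs_eq)
qed

instance L1 :: banach
proof
  fix X :: "nat \<Rightarrow> L1" assume C: "Cauchy X"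
  have "\<exists>s. \<forall>n. integrable unit_leb (s n) \<and> X n = L1_of_L0 (abs_L0 (s n))"
    by (intro choice allI) (meson L1_cases)
  then obtain s where s: "\<And>n. integrable unit_leb (s n)"
    and X: "\<And>n. X n = L1_of_L0 (abs_L0 (s n))"
    by blast
  have m[measurable]: "s n \<in> borel_measurable unit_leb" for n
    using s by auto
  have Cs: "\<exists>N. \<forall>i\<ge>N. \<forall>j\<ge>N. (LINT x|unit_leb. norm (s i x - s j x)) < e" if "e > 0" for e
    using CauchyD[OF C that] by (simp add: X norm_diff_L1 s)
  obtain r where r: "strict_mono r" and ae: "AE x in unit_leb. Cauchy (\<lambda>i. s (r i) x)"
    using cauchy_L1_AE_cauchy_subseq[OF s Cs] by blast
  define h where "h x = lim (\<lambda>i. s (r i) x)" for x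
  have h[measurable]: "h \<in> borel_measurable unit_leb"
    unfolding h_def by measurable
  have lim: "AE x in unit_leb. (\<lambda>i. s (r i) x) \<longlonglongrightarrow> h x"
    using ae by eventually_elim (simp add: h_def Cauchy_convergent_iff convergent_LIMSEQ_iff)
  have bnd: "(\<integral>\<^sup>+x. ennreal \<bar>s n x - h x\<bar> \<partial>unit_leb) \<le> ennreal e"
    if N: "\<forall>i\<ge>N. \<forall>j\<ge>N. (LINT x|unit_leb. norm (s i x - s j x)) < e" and n: "n \<ge> N" for N n e
  proof -
    have "(\<integral>\<^sup>+x. ennreal \<bar>s n x - h x\<bar> \<partial>unit_leb)
        = (\<integral>\<^sup>+x. liminf (\<lambda>i. ennreal \<bar>s n x - s (r i) x\<bar>) \<partial>unit_leb)"
    proof (rule nn_integral_cong_AE, use lim in eventually_elim)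
      case (elim x)
      have "(\<lambda>i. ennreal \<bar>s n x - s (r i) x\<bar>) \<longlonglongrightarrow> ennreal \<bar>s n x - h x\<bar>"
        by (intro tendsto_ennrealI tendsto_intros elim)
      from lim_imp_Liminf[OF sequentially_bot this] show ?case
        by simp
    qed
    also have "\<dots> \<le> liminf (\<lambda>i. \<integral>\<^sup>+x. ennreal \<bar>s n x - s (r i) x\<bar> \<partial>unit_leb)"
      by (rule nn_integral_liminf) measurable
    also have "\<dots> \<le> liminf (\<lambda>i::nat. ennreal e)"
    proof (rule Liminf_mono)
      show "\<forall>\<^sub>F i in sequentially. (\<integral>\<^sup>+x. ennreal \<bar>s n x - s (r i) x\<bar> \<partial>unit_leb) \<le> ennreal e"
        using eventually_ge_at_top[of N]
      proof eventually_elim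
        case (elim i)
        then have "r i \<ge> N" using seq_suble[OF r, of i] by simp
        then have "(LINT x|unit_leb. \<bar>s n x - s (r i) x\<bar>) \<le> e"
          using N n by fastforce
        moreover have "(\<integral>\<^sup>+x. ennreal \<bar>s n x - s (r i) x\<bar> \<partial>unit_leb)
            = ennreal (LINT x|unit_leb. \<bar>s n x - s (r i) x\<bar>)"
          by (rule nn_integral_eq_integral) (use s in auto)
        ultimately show ?case by (simp add: ennreal_leI)
      qed
    qed
    also have "\<dots> = ennreal e" by (simp add: Liminf_const)
    finally show ?thesis .
  qed
  obtain N1 where N1: "\<forall>i\<ge>N1. \<forall>j\<ge>N1. (LINT x|unit_leb. norm (s i x - s j x)) < 1"
    using Cs[of 1] by auto
  have "integrable unit_leb (\<lambda>x. s N1 x - h x)"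
    using bnd[OF N1 order_refl] by (intro integrableI_bounded) (auto intro: le_less_trans)
  from Bochner_Integration.integrable_diff[OF s[of N1] this] have ih: "integrable unit_leb h"
    by simp
  have "X \<longlonglongrightarrow> L1_of_L0 (abs_L0 h)"
  proof (rule LIMSEQ_I)
    fix e :: real assume e: "0 < e"
    then obtain N where N: "\<forall>i\<ge>N. \<forall>j\<ge>N. (LINT x|unit_leb. norm (s i x - s j x)) < e/2"
      using Cs[of "e/2"] by auto
    show "\<exists>no. \<forall>n\<ge>no. norm (X n - L1_of_L0 (abs_L0 h)) < e"
    proof (intro exI allI impI)
      fix n assume "n \<ge> N"
      from bnd[OF N this] have "ennreal (LINT x|unit_leb. \<bar>s n x - h x\<bar>) \<le> ennreal (e/2)"
        by (subst (asm) nn_integral_eq_integral) (use s ih in auto)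
      then show "norm (X n - L1_of_L0 (abs_L0 h)) < e"
        using e by (simp add: X norm_diff_L1 s ih)
    qed
  qed
  then show "convergent X" by (rule convergentI)
qed

text \<open>The space is given as a linear subspace \<open>X\<close> of an ambient normed space, with the
  inherited norm.\<close>

definition cof :: "'a::real_normed_vector set \<Rightarrow> 'a set set" where
  "cof X = {Z. subspace Z \<and> closedin (top_of_set X) Z \<and> (\<exists>F. finite F \<and> span (Z \<union> F) = X)}"

text \<open>In \<^typ>\<open>ereal\<close> the infimum over the empty set is \<open>\<infinity>\<close>.\<close>

definition amuc_modulus :: "'a::real_normed_vector set \<Rightarrow> real \<Rightarrow> ereal" where
  "amuc_modulus X t =
     (INF x \<in> X \<inter> sphere 0 1. SUP Z \<in> cof X. INF z \<in> Z \<inter> sphere 0 1.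
        ereal (max (norm (x + t *\<^sub>R z)) (norm (x - t *\<^sub>R z)) - 1))"

definition asymptotically_midpoint_uniformly_convex :: "'a::real_normed_vector set \<Rightarrow> bool" where
  "asymptotically_midpoint_uniformly_convex X \<longleftrightarrow> (\<forall>t>0. amuc_modulus X t > 0)"

end

theory Submission
  imports Defs
begin

text \<open>
  The proof shows \<open>amuc_modulus Y t \<ge> t / 4\<close>. It rests on the pointwise identity
  \<open>\<bar>a + p\<bar> + \<bar>a - p\<bar> = 2 * max \<bar>a\<bar> \<bar>p\<bar>\<close>: if \<open>x\<close> has norm one and both \<open>x + w\<close> and \<open>x - w\<close> have
  norm less than \<open>1 + \<delta>\<close>, then the positive part of \<open>\<bar>w\<bar> - \<bar>x\<bar>\<close> has integral less than \<open>\<delta>\<close>. So \<open>w\<close>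
  is \<open>\<delta>\<close>-close to the order interval of functions dominated by \<open>\<bar>x\<bar>\<close>. That interval is uniformly
  integrable, so there closeness in measure forces closeness in norm, and two such \<open>w\<close> that are
  sufficiently close in measure are at norm distance less than \<open>2 * \<delta> + \<epsilon>\<close>
  (\<open>almost_midpoints_close_in_measure_imp_close\<close>).

  Fix \<open>x\<close> in the unit sphere of \<open>Y\<close> and let \<open>M\<close> be the set of the unit vectors \<open>z\<close> of \<open>Y\<close> that
  violate the desired bound, that is, \<open>x + t z\<close> and \<open>x - t z\<close> have norm less than \<open>1 + t / 4\<close>. By the
  compactness assumption \<open>M\<close> has, for the metric of convergence in measure, a finite net \<open>C \<subseteq> M\<close> as
  fine as we like (\<open>finite_net_in_preimage\<close>). With \<open>\<delta> = t / 4\<close> and \<open>\<epsilon> = t / 2\<close> this means that every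
  \<open>z\<close> in \<open>M\<close> satisfies \<open>t * norm (z - c) < t\<close> for some \<open>c\<close> in \<open>C\<close>. On the other hand, each \<open>c\<close> is
  normed by the functional \<open>v \<mapsto> \<integral> sgn c * v\<close> of norm at most one, so vectors in its kernel have
  distance at least \<open>norm c = 1\<close> from \<open>c\<close>. The common kernel in \<open>Y\<close> of these finitely many functionals
  is closed and of finite codimension (\<open>common_kernel_in_cof\<close>), and it misses \<open>M\<close>. It depends on
  \<open>x\<close>, but the bound \<open>t / 4\<close> does not.
\<close>

section \<open>Almost midpoints and convergence in measure\<close>

lemma truncation_tail_small:
  fixes g :: "'a \<Rightarrow> real"
  assumes g: "integrable M g" and e: "0 < e"
  shows "\<exists>n::nat. (LINT x|M. max 0 (\<bar>g x\<bar> - real n)) < e"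
proof -
  have "(\<lambda>n. LINT x|M. max 0 (\<bar>g x\<bar> - real n)) \<longlonglongrightarrow> (LINT x|M. 0)"
  proof (rule integral_dominated_convergence[where w="\<lambda>x. \<bar>g x\<bar>"])
    show "AE x in M. (\<lambda>n. max 0 (\<bar>g x\<bar> - real n)) \<longlonglongrightarrow> 0"
    proof (rule AE_I2)
      fix x
      obtain N :: nat where N: "\<bar>g x\<bar> \<le> real N" using real_arch_simple by blast
      show "(\<lambda>n. max 0 (\<bar>g x\<bar> - real n)) \<longlonglongrightarrow> 0"
        by (rule tendsto_eventually, rule eventually_sequentiallyI[of N]) (use N in auto)
    qed
  qed (use g in auto)
  then have "\<forall>\<^sub>F n in sequentially. (LINT x|M. max 0 (\<bar>g x\<bar> - real n)) < e"
    using e by (intro order_tendstoD(2)) auto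
  then show ?thesis by (auto simp: eventually_sequentially)
qed

lemma mean_abs_add_diff_eq_max:
  fixes a p :: real
  shows "(\<bar>a + p\<bar> + \<bar>a - p\<bar>) / 2 = max \<bar>a\<bar> \<bar>p\<bar>"
  unfolding abs_if max_def by (simp add: field_simps)

text \<open>
  This is the pointwise form of the estimate: a difference of two values is at most the truncated
  tail of \<open>2 * \<bar>a\<bar>\<close> at height \<open>N\<close>, plus the part below \<open>N\<close>, plus the amounts by which the two values
  exceed \<open>\<bar>a\<bar>\<close>. The part below \<open>N\<close> appears as a multiple of \<open>min 1 \<bar>b - c\<bar>\<close>, the integrand of the
  metric of convergence in measure. The excess is written with \<open>\<bar>a + p\<bar>\<close> and \<open>\<bar>a - p\<bar>\<close>, so that it
  integrates to a combination of norms.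
\<close>

lemma abs_diff_le_truncated_plus_excess:
  fixes a b c N t :: real
  assumes N: "1 \<le> N" and t: "0 \<le> t"
  shows "t * \<bar>b - c\<bar> \<le> max 0 (2 * \<bar>a\<bar> - N) + N * (1 + t) * min 1 \<bar>b - c\<bar>
      + ((\<bar>a + t * b\<bar> + \<bar>a - t * b\<bar>) / 2 - \<bar>a\<bar>) + ((\<bar>a + t * c\<bar> + \<bar>a - t * c\<bar>) / 2 - \<bar>a\<bar>)"
proof -
  have capped: "min N (t * \<bar>b - c\<bar>) \<le> N * (1 + t) * min 1 \<bar>b - c\<bar>"
  proof (cases "\<bar>b - c\<bar> \<le> 1")
    case True
    have "1 * (1 + t) \<le> N * (1 + t)" using N t by (intro mult_right_mono) auto
    then have "t * \<bar>b - c\<bar> \<le> (N * (1 + t)) * \<bar>b - c\<bar>"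
      by (intro mult_right_mono) auto
    then show ?thesis using True by simp
  next
    case False
    have "N \<le> N * (1 + t)" using N t by (simp add: algebra_simps)
    then show ?thesis using False by simp
  qed
  \<comment> \<open>The arithmetic core, with \<open>d\<close> for \<open>t * \<bar>b - c\<bar>\<close>: either \<open>n = d\<close>, and the rest is
    nonnegative, or \<open>n = N\<close>, and \<open>d \<le> B + C \<le> 2 * A + (P - A) + (Q - A)\<close>,
    where \<open>2 * A \<le> T + N\<close>.\<close>
  have split: "d \<le> T + n + (P - A) + (Q - A)"
    if "d \<le> B + C" "B \<le> P" "C \<le> Q" "A \<le> P" "A \<le> Q" "0 \<le> T" "2 * A - N \<le> T" "n = N \<or> n = d"
    for d n A B C P Q T :: real
    using that by linarith
  have "t * \<bar>b - c\<bar> = \<bar>t * b - t * c\<bar>"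
    using t by (simp add: abs_mult right_diff_distrib[symmetric])
  then have "t * \<bar>b - c\<bar> \<le> \<bar>t * b\<bar> + \<bar>t * c\<bar>"
    by (metis abs_triangle_ineq4)
  then have "t * \<bar>b - c\<bar> \<le> max 0 (2 * \<bar>a\<bar> - N) + min N (t * \<bar>b - c\<bar>)
      + (max \<bar>a\<bar> \<bar>t * b\<bar> - \<bar>a\<bar>) + (max \<bar>a\<bar> \<bar>t * c\<bar> - \<bar>a\<bar>)"
    by (rule split) (auto simp: min_def)
  also have "\<dots> \<le> max 0 (2 * \<bar>a\<bar> - N) + N * (1 + t) * min 1 \<bar>b - c\<bar>
      + (max \<bar>a\<bar> \<bar>t * b\<bar> - \<bar>a\<bar>) + (max \<bar>a\<bar> \<bar>t * c\<bar> - \<bar>a\<bar>)"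
    by (intro add_right_mono add_left_mono capped)
  finally show ?thesis
    unfolding mean_abs_add_diff_eq_max .
qed

text \<open>
  The summand that belongs to \<open>z\<close> measures by how much the norms of \<open>x + t z\<close> and \<open>x - t z\<close> exceed
  that of \<open>x\<close> on average; it equals the integral of the positive part of \<open>t * \<bar>z\<bar> - \<bar>x\<bar>\<close>, and
  likewise for \<open>z'\<close>. Uniform integrability of the functions dominated by \<open>\<bar>x\<bar>\<close> enters through
  the height \<open>N\<close>, which depends on \<open>x\<close> and \<open>e\<close> alone; this is why one \<open>r\<close> serves all pairs.
\<close>

lemma almost_midpoints_close_in_measure_imp_close:
  fixes x :: L1
  assumes "0 < t" "0 < e"
  shows "\<exists>r>0. \<forall>z z'. dist (L0_of_L1 z) (L0_of_L1 z') < r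
    \<longrightarrow> t * norm (z - z') < e
      + ((norm (x + t *\<^sub>R z) + norm (x - t *\<^sub>R z)) / 2 - norm x)
      + ((norm (x + t *\<^sub>R z') + norm (x - t *\<^sub>R z')) / 2 - norm x)"
  using assms
proof (transfer, transfer)
  fix t e :: real and x :: "real \<Rightarrow> real"
  assume t: "0 < t" and e: "0 < e" and x: "integrable unit_leb x"
  obtain n where n: "(LINT s|unit_leb. max 0 (\<bar>2 * x s\<bar> - real n)) < e / 2"
    using truncation_tail_small[of unit_leb "\<lambda>s. 2 * x s" "e / 2"] x e by auto
  define N where "N = max 1 (real n)"
  have N: "1 \<le> N" by (simp add: N_def)
  have "(LINT s|unit_leb. max 0 (\<bar>2 * x s\<bar> - N)) \<le> (LINT s|unit_leb. max 0 (\<bar>2 * x s\<bar> - real n))"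
    by (rule integral_mono) (use x in \<open>auto simp: N_def\<close>)
  with n have tail: "(LINT s|unit_leb. max 0 (2 * \<bar>x s\<bar> - N)) < e / 2"
    by (simp add: abs_mult)
  define K where "K = N * (1 + t)"
  have K: "0 < K" using N t by (simp add: K_def)
  show "\<exists>r>0. \<forall>z\<in>{z. integrable unit_leb z \<and> ae_eq z z}. \<forall>z'\<in>{z. integrable unit_leb z \<and> ae_eq z z}.
      (LINT s|unit_leb. min 1 \<bar>z s - z' s\<bar>) < r \<longrightarrow>
      t * (LINT s|unit_leb. \<bar>z s - z' s\<bar>) < e
        + (((LINT s|unit_leb. \<bar>x s + t * z s\<bar>) + (LINT s|unit_leb. \<bar>x s - t * z s\<bar>)) / 2
           - (LINT s|unit_leb. \<bar>x s\<bar>))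
        + (((LINT s|unit_leb. \<bar>x s + t * z' s\<bar>) + (LINT s|unit_leb. \<bar>x s - t * z' s\<bar>)) / 2
           - (LINT s|unit_leb. \<bar>x s\<bar>))"
  proof (intro exI[of _ "e / (2 * K)"] conjI ballI impI)
    show "0 < e / (2 * K)" using e K by simp
  next
    fix z z' :: "real \<Rightarrow> real"
    assume "z \<in> {z. integrable unit_leb z \<and> ae_eq z z}" "z' \<in> {z. integrable unit_leb z \<and> ae_eq z z}"
      and "(LINT s|unit_leb. min 1 \<bar>z s - z' s\<bar>) < e / (2 * K)"
    then have z: "integrable unit_leb z" and z': "integrable unit_leb z'"
      and close: "K * (LINT s|unit_leb. min 1 \<bar>z s - z' s\<bar>) < e / 2"
      using K by (simp_all add: field_simps)
    have trunc: "integrable unit_leb (\<lambda>s. max 0 (2 * \<bar>x s\<bar> - N))"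
      by (rule Bochner_Integration.integrable_bound[of _ "\<lambda>s. 2 * x s"]) (use x N in auto)
    have min: "integrable unit_leb (\<lambda>s. min 1 \<bar>z s - z' s\<bar>)"
      using z z' by (intro integrable_min_abs_diff borel_measurable_integrable)
    have exc: "integrable unit_leb (\<lambda>s. (\<bar>x s + t * w s\<bar> + \<bar>x s - t * w s\<bar>) / 2 - \<bar>x s\<bar>)"
      "(LINT s|unit_leb. (\<bar>x s + t * w s\<bar> + \<bar>x s - t * w s\<bar>) / 2 - \<bar>x s\<bar>)
        = ((LINT s|unit_leb. \<bar>x s + t * w s\<bar>) + (LINT s|unit_leb. \<bar>x s - t * w s\<bar>)) / 2
          - (LINT s|unit_leb. \<bar>x s\<bar>)" if "integrable unit_leb w" for w
      using x that by simp_all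
    have "t * (LINT s|unit_leb. \<bar>z s - z' s\<bar>) = (LINT s|unit_leb. t * \<bar>z s - z' s\<bar>)"
      by simp
    also have "\<dots> \<le> (LINT s|unit_leb. max 0 (2 * \<bar>x s\<bar> - N) + K * min 1 \<bar>z s - z' s\<bar>
        + ((\<bar>x s + t * z s\<bar> + \<bar>x s - t * z s\<bar>) / 2 - \<bar>x s\<bar>)
        + ((\<bar>x s + t * z' s\<bar> + \<bar>x s - t * z' s\<bar>) / 2 - \<bar>x s\<bar>))"
    proof (rule integral_mono)
      show "integrable unit_leb (\<lambda>s. t * \<bar>z s - z' s\<bar>)" using z z' by simp
      show "t * \<bar>z s - z' s\<bar> \<le> max 0 (2 * \<bar>x s\<bar> - N) + K * min 1 \<bar>z s - z' s\<bar>
          + ((\<bar>x s + t * z s\<bar> + \<bar>x s - t * z s\<bar>) / 2 - \<bar>x s\<bar>)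
          + ((\<bar>x s + t * z' s\<bar> + \<bar>x s - t * z' s\<bar>) / 2 - \<bar>x s\<bar>)" for s
        unfolding K_def using N t by (intro abs_diff_le_truncated_plus_excess) simp_all
    qed (intro Bochner_Integration.integrable_add integrable_mult_right trunc min
        exc(1)[OF z] exc(1)[OF z'])
    also have "\<dots> = (LINT s|unit_leb. max 0 (2 * \<bar>x s\<bar> - N))
        + K * (LINT s|unit_leb. min 1 \<bar>z s - z' s\<bar>)
        + (LINT s|unit_leb. (\<bar>x s + t * z s\<bar> + \<bar>x s - t * z s\<bar>) / 2 - \<bar>x s\<bar>)
        + (LINT s|unit_leb. (\<bar>x s + t * z' s\<bar> + \<bar>x s - t * z' s\<bar>) / 2 - \<bar>x s\<bar>)"
      by (simp only: Bochner_Integration.integral_add Bochner_Integration.integrable_add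
          integrable_mult_right integral_mult_right_zero trunc min exc(1)[OF z] exc(1)[OF z'])
    also have "\<dots> < e + (LINT s|unit_leb. (\<bar>x s + t * z s\<bar> + \<bar>x s - t * z s\<bar>) / 2 - \<bar>x s\<bar>)
        + (LINT s|unit_leb. (\<bar>x s + t * z' s\<bar> + \<bar>x s - t * z' s\<bar>) / 2 - \<bar>x s\<bar>)"
      using add_strict_mono[OF tail close]
      unfolding field_sum_of_halves by (intro add_strict_right_mono)
    finally show "t * (LINT s|unit_leb. \<bar>z s - z' s\<bar>) < e
        + (((LINT s|unit_leb. \<bar>x s + t * z s\<bar>) + (LINT s|unit_leb. \<bar>x s - t * z s\<bar>)) / 2
           - (LINT s|unit_leb. \<bar>x s\<bar>))
        + (((LINT s|unit_leb. \<bar>x s + t * z' s\<bar>) + (LINT s|unit_leb. \<bar>x s - t * z' s\<bar>)) / 2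
           - (LINT s|unit_leb. \<bar>x s\<bar>))"
      unfolding exc(2)[OF z] exc(2)[OF z'] .
  qed
qed

section \<open>Norming functionals and finite codimension\<close>

lift_definition sign_pairing_L0 :: "L0 \<Rightarrow> L0 \<Rightarrow> real" is
  "\<lambda>f g. LINT s|unit_leb. sgn (f s) * g s"
proof -
  fix f f' g g' assume "ae_eq f f'" "ae_eq g g'"
  then have m[measurable]: "f \<in> borel_measurable unit_leb" "f' \<in> borel_measurable unit_leb"
    "g \<in> borel_measurable unit_leb" "g' \<in> borel_measurable unit_leb"
    and ae: "AE x in unit_leb. f x = f' x" "AE x in unit_leb. g x = g' x"
    by (auto simp: ae_eq_def)
  have "AE s in unit_leb. sgn (f s) * g s = sgn (f' s) * g' s"
    using ae by eventually_elim simp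
  then show "(LINT s|unit_leb. sgn (f s) * g s) = (LINT s|unit_leb. sgn (f' s) * g' s)"
    by (intro integral_cong_AE) simp_all
qed

text \<open>
  As a function of the second argument, this is a norming functional of the first one; over
  \<open>L1\<close> it can be written down explicitly.
\<close>

lift_definition sign_pairing :: "L1 \<Rightarrow> L1 \<Rightarrow> real" is sign_pairing_L0 .

lemma integrable_sgn_mult:
  fixes f g :: "'a \<Rightarrow> real"
  assumes [measurable]: "f \<in> borel_measurable M" and g: "integrable M g"
  shows "integrable M (\<lambda>s. sgn (f s) * g s)"
  by (rule Bochner_Integration.integrable_bound[OF g]) (use g in \<open>auto simp: abs_mult sgn_if\<close>)

lemma sign_pairing_self: "sign_pairing z z = norm z"
  by (transfer, transfer) (auto intro!: Bochner_Integration.integral_cong simp: sgn_if)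

lemma abs_sign_pairing_le_norm: "\<bar>sign_pairing z v\<bar> \<le> norm v"
proof (transfer, transfer)
  fix z v :: "real \<Rightarrow> real"
  assume z: "integrable unit_leb z" and v: "integrable unit_leb v"
  have "integrable unit_leb (\<lambda>s. sgn (z s) * v s)"
    using z v by (intro integrable_sgn_mult borel_measurable_integrable)
  then have "(LINT s|unit_leb. \<bar>sgn (z s) * v s\<bar>) \<le> (LINT s|unit_leb. \<bar>v s\<bar>)"
    using v by (intro integral_mono integrable_abs) (auto simp: sgn_if)
  then show "\<bar>LINT s|unit_leb. sgn (z s) * v s\<bar> \<le> (LINT s|unit_leb. \<bar>v s\<bar>)"
    by (rule order_trans[OF integral_abs_bound])
qed

lemma sign_pairing_bounded_linear: "bounded_linear (sign_pairing z)"
proof (rule bounded_linear_intro[where K=1])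
  fix v w :: L1 and c :: real
  show "sign_pairing z (v + w) = sign_pairing z v + sign_pairing z w"
    by (transfer, transfer) (simp add: distrib_left integrable_sgn_mult)
  show "sign_pairing z (c *\<^sub>R v) = c *\<^sub>R sign_pairing z v"
    by (transfer, transfer) (simp add: mult.left_commute)
  show "norm (sign_pairing z v) \<le> norm v * 1"
    using abs_sign_pairing_le_norm by simp
qed

lemma cof_self:
  assumes "subspace X"
  shows "X \<in> cof X"
proof -
  have "span (X \<union> {}) = X" using assms by (simp add: span_eq_iff)
  then show ?thesis
    using assms unfolding cof_def by (intro CollectI conjI exI[of _ "{}"]) auto
qed

text \<open>
  Intersecting with the kernel of a functional costs at most one dimension: if \<open>f v \<noteq> 0\<close>, then
  every \<open>z\<close> in \<open>Z\<close> is a kernel element plus a multiple of \<open>v\<close>.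
\<close>

lemma cof_Int_kernel:
  assumes Z: "Z \<in> cof X" and f: "bounded_linear f"
  shows "{z \<in> Z. f z = (0::real)} \<in> cof X"
proof -
  interpret f: bounded_linear f by (rule f)
  let ?K = "{z \<in> Z. f z = 0}"
  obtain F where sZ: "subspace Z" and cl: "closedin (top_of_set X) Z"
    and F: "finite F" "span (Z \<union> F) = X"
    using Z by (auto simp: cof_def)
  have "closed {z. f z = 0}"
    by (intro closed_Collect_eq continuous_intros f.continuous_on)
  then have "closedin (top_of_set X) (Z \<inter> {z. f z = 0})"
    using cl by (metis closedin_Int closedin_closed_Int inf.absorb_iff1 inf_assoc closedin_imp_subset)
  moreover have "subspace ?K"
    using sZ by (auto simp: subspace_def f.add f.scaleR f.zero)
  moreover have "\<exists>G. finite G \<and> span (?K \<union> G) = X"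
  proof (cases "\<exists>v\<in>Z. f v \<noteq> 0")
    case True
    then obtain v where v: "v \<in> Z" "f v \<noteq> 0" by blast
    have Zs: "Z \<subseteq> span (?K \<union> insert v F)"
    proof
      fix z assume z: "z \<in> Z"
      let ?k = "z - (f z / f v) *\<^sub>R v"
      have "?k \<in> ?K"
        using z v sZ by (simp add: subspace_diff subspace_scale f.diff f.scaleR)
      then have "?k + (f z / f v) *\<^sub>R v \<in> span (?K \<union> insert v F)"
        by (intro span_add span_scale span_base) auto
      then show "z \<in> span (?K \<union> insert v F)" by simp
    qed
    have "span (?K \<union> insert v F) = X"
    proof (rule antisym)
      show "span (?K \<union> insert v F) \<subseteq> X"
        unfolding F(2)[symmetric] by (rule span_mono) (use v in auto)
      have "Z \<union> F \<subseteq> span (?K \<union> insert v F)"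
        using Zs by (auto intro: span_base)
      then show "X \<subseteq> span (?K \<union> insert v F)"
        unfolding F(2)[symmetric] by (rule span_minimal) simp
    qed
    then show ?thesis using F(1) by (intro exI[of _ "insert v F"]) auto
  next
    case False
    then have "?K = Z" by auto
    then show ?thesis using F by auto
  qed
  ultimately show ?thesis unfolding cof_def by (simp add: Int_def)
qed

lemma common_kernel_in_cof:
  assumes "finite I" "subspace X" "\<And>i. i \<in> I \<Longrightarrow> bounded_linear (f i)"
  shows "{z \<in> X. \<forall>i\<in>I. f i z = (0::real)} \<in> cof X"
  using assms(1,3)
proof (induction I)
  case empty
  then show ?case using cof_self[OF assms(2)] by simp
next
  case (insert i I)
  have "{z \<in> {z \<in> X. \<forall>j\<in>I. f j z = 0}. f i z = 0} \<in> cof X"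
    by (intro cof_Int_kernel insert) (use insert.prems in auto)
  moreover have "{z \<in> {z \<in> X. \<forall>j\<in>I. f j z = 0}. f i z = 0}
      = {z \<in> X. \<forall>j\<in>insert i I. f j z = 0}"
    by auto
  ultimately show ?case by simp
qed

section \<open>Finite nets\<close>

text \<open>
  The net can be taken inside \<open>M\<close> although it is the image of a larger set that is relatively
  compact: cover by balls of half the radius and pick a point of \<open>M\<close> for each ball that meets
  the image of \<open>M\<close>.
\<close>

lemma finite_net_in_preimage:
  fixes h :: "'a \<Rightarrow> 'b::metric_space"
  assumes K: "compact (closure (h ` B))" and M: "M \<subseteq> B" and r: "0 < r"
  shows "\<exists>C. finite C \<and> C \<subseteq> M \<and> (\<forall>z\<in>M. \<exists>c\<in>C. dist (h z) (h c) < r)"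
proof -
  obtain K where K: "finite K" "closure (h ` B) \<subseteq> (\<Union>k\<in>K. ball k (r / 2))"
    using seq_compact_imp_totally_bounded[OF compact_imp_seq_compact[OF K]] r
    by (meson half_gt_zero)
  let ?K = "{k \<in> K. \<exists>c\<in>M. dist k (h c) < r / 2}"
  obtain c where c: "\<And>k. k \<in> ?K \<Longrightarrow> c k \<in> M \<and> dist k (h (c k)) < r / 2"
    using bchoice[of ?K "\<lambda>k c. c \<in> M \<and> dist k (h c) < r / 2"] by blast
  have "\<exists>d\<in>c ` ?K. dist (h z) (h d) < r" if z: "z \<in> M" for z
  proof -
    have "h z \<in> closure (h ` B)"
      using z M closure_subset by blast
    then obtain k where k: "k \<in> K" "dist k (h z) < r / 2"
      using K(2) by auto
    then have "k \<in> ?K" using z by blast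
    then show ?thesis
      using c[of k] k(2) dist_triangle_half_r[of k "h z" r "h (c k)"] by blast
  qed
  then show ?thesis
    using K(1) c by (intro exI[of _ "c ` ?K"]) auto
qed

section \<open>The lower bound for the modulus\<close>

theorem theorem1:
  fixes Y :: "L1 set"
  assumes "subspace Y" and "closed Y"
    and "compact (closure (L0_of_L1 ` (Y \<inter> cball 0 1)))"
  shows "asymptotically_midpoint_uniformly_convex Y"
  unfolding asymptotically_midpoint_uniformly_convex_def
proof (intro allI impI)
  fix t :: real assume t: "0 < t"
  have big: "\<exists>Z\<in>cof Y. \<forall>z\<in>Z \<inter> sphere 0 1. t / 4 \<le> max (norm (x + t *\<^sub>R z)) (norm (x - t *\<^sub>R z)) - 1"
    if x: "x \<in> Y \<inter> sphere 0 1" for x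
  proof -
    define M where "M = {z \<in> Y \<inter> sphere 0 1.
      max (norm (x + t *\<^sub>R z)) (norm (x - t *\<^sub>R z)) - 1 < t / 4}"
    obtain r where r: "0 < r" and close: "\<And>z z'. dist (L0_of_L1 z) (L0_of_L1 z') < r \<Longrightarrow>
        t * norm (z - z') < t / 2
          + ((norm (x + t *\<^sub>R z) + norm (x - t *\<^sub>R z)) / 2 - norm x)
          + ((norm (x + t *\<^sub>R z') + norm (x - t *\<^sub>R z')) / 2 - norm x)"
      using almost_midpoints_close_in_measure_imp_close[of t "t / 2" x] t by auto
    have "M \<subseteq> Y \<inter> cball 0 1" by (auto simp: M_def)
    from finite_net_in_preimage[OF assms(3) this r]
    obtain C where C: "finite C" "C \<subseteq> M"
      and net: "\<And>z. z \<in> M \<Longrightarrow> \<exists>c\<in>C. dist (L0_of_L1 z) (L0_of_L1 c) < r"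
      by blast
    let ?Z = "{z \<in> Y. \<forall>c\<in>C. sign_pairing c z = 0}"
    have "?Z \<in> cof Y"
      using C(1) assms(1) by (rule common_kernel_in_cof) (rule sign_pairing_bounded_linear)
    moreover have "z \<notin> M" if z: "z \<in> ?Z" for z
    proof
      assume zM: "z \<in> M"
      then obtain c where c: "c \<in> C" and d: "dist (L0_of_L1 z) (L0_of_L1 c) < r"
        using net by blast
      interpret c: bounded_linear "sign_pairing c" by (rule sign_pairing_bounded_linear)
      have cM: "c \<in> M" using c C by blast
      \<comment> \<open>The average of the two norms is at most their maximum.\<close>
      have small: "(norm (x + t *\<^sub>R w) + norm (x - t *\<^sub>R w)) / 2 - norm x < t / 4"
        if "w \<in> M" for w
      proof -
        have "max (norm (x + t *\<^sub>R w)) (norm (x - t *\<^sub>R w)) < 1 + t / 4" "norm x = 1"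
          using that x by (auto simp: M_def)
        then show ?thesis unfolding max_less_iff_conj by (simp add: field_simps)
      qed
      have "t * norm (z - c) < t"
        using close[OF d] small[OF zM] small[OF cM] by linarith
      then have "norm (z - c) < 1" using t by simp
      moreover have "1 \<le> norm (c - z)"
      proof -
        have "sign_pairing c (c - z) = 1"
          using z c cM by (simp add: c.diff sign_pairing_self M_def)
        then show ?thesis using abs_sign_pairing_le_norm[of c "c - z"] by simp
      qed
      ultimately show False by (simp add: norm_minus_commute)
    qed
    ultimately show ?thesis by (intro bexI[of _ ?Z]) (auto simp: M_def not_less)
  qed
  have "ereal (t / 4) \<le> amuc_modulus Y t"
    unfolding amuc_modulus_def
  proof (rule INF_greatest)
    fix x assume "x \<in> Y \<inter> sphere 0 1"
    from big[OF this] obtain Z where Z: "Z \<in> cof Y"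
      and le: "\<And>z. z \<in> Z \<inter> sphere 0 1 \<Longrightarrow>
        t / 4 \<le> max (norm (x + t *\<^sub>R z)) (norm (x - t *\<^sub>R z)) - 1"
      by blast
    show "ereal (t / 4) \<le> (SUP Z\<in>cof Y. INF z\<in>Z \<inter> sphere 0 1.
        ereal (max (norm (x + t *\<^sub>R z)) (norm (x - t *\<^sub>R z)) - 1))"
      by (rule SUP_upper2[OF Z], rule INF_greatest, simp only: ereal_less_eq(3), rule le)
  qed
  moreover have "0 < ereal (t / 4)" using t by simp
  ultimately show "0 < amuc_modulus Y t" by (rule less_le_trans[rotated])
qed

end
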